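(* Let $a_1, a_2, a_3\in\mathbb{N}$. For $1\le i<j\le 3$ put $a_{ij}:=a_k$ where $\{k\}=\{1,2,3\}\setminus\{i,j\}$. Then $$ \operatorname{CT}\prod_{1\leq i < j\leq 3} (y_i/y_j;q)_{a_{ij}}\,(q\,y_j/y_i;q)_{a_{ij}} = \frac{[a_1+a_2+a_3]_q^!\,\prod_{i=1}^3 [2a_i]_q^!}{\prod_{i=1}^3 [a_i]_q^!\,\prod_{1\leq i< j\leq 3}[a_i+a_j]_q^!}. $$
   Context: $\mathbb{N}=\{0,1,2,\ldots\}$. Here $q$ is a formal variable and $y_1,y_2,y_3$ are commuting indeterminates. For $a\in\mathbb{N}$, $(x;q)_a=\prod_{i=0}^{a-1}(1-xq^i)$ (so $(x;q)_0=1$) and $[a]_q^!=\frac{(q;q)_a}{(1-q)^a}$. $\operatorname{CT}$ denotes the constant term of a Laurent polynomial in $y_1,y_2,y_3$ (with coefficients polynomials in $q$), i.e. the coefficient of $y_1^0y_2^0y_3^0$. *)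

theory Defs
  imports
    "HOL-Library.Poly_Mapping"
    "HOL-Library.Product_Plus"
    "HOL-Computational_Algebra.Polynomial_Factorial"
begin

definition qpoch :: "'a::comm_ring_1 \<Rightarrow> 'a \<Rightarrow> nat \<Rightarrow> 'a" where
  "qpoch x q a = (\<Prod>i<a. 1 - x * q ^ i)"

definition qfact :: "'a::field \<Rightarrow> nat \<Rightarrow> 'a" where
  "qfact q a = qpoch q q a / (1 - q) ^ a"

text \<open>
  Laurent polynomials in \<open>y\<^sub>1, y\<^sub>2, y\<^sub>3\<close> over \<open>\<int>[q]\<close>: the group algebra of \<open>\<int>\<^sup>3\<close>
  over \<^typ>\<open>int poly\<close>. A key \<open>(e\<^sub>1, e\<^sub>2, e\<^sub>3)\<close> is the exponent vector of a monomial, and the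
  multiplication of \<^type>\<open>poly_mapping\<close> is convolution.
\<close>

type_synonym laurent3 = "(int \<times> int \<times> int) \<Rightarrow>\<^sub>0 int poly"

definition q_laurent :: laurent3 where
  "q_laurent = Poly_Mapping.single 0 [:0, 1:]"

text \<open>\<open>y_pow i n\<close> is \<open>y\<^sub>i\<^sup>n\<close>, meaningful for \<open>i \<in> {1, 2, 3}\<close> and any integer \<open>n\<close>.\<close>

definition y_pow :: "nat \<Rightarrow> int \<Rightarrow> laurent3" where
  "y_pow i n = Poly_Mapping.single
     (if i = 1 then n else 0, if i = 2 then n else 0, if i = 3 then n else 0) 1"

definition y_ratio :: "nat \<Rightarrow> nat \<Rightarrow> laurent3" where
  "y_ratio i j = y_pow i 1 * y_pow j (- 1)"

definition CT :: "laurent3 \<Rightarrow> int poly" where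
  "CT f = Poly_Mapping.lookup f (0, 0, 0)"

definition third :: "nat \<Rightarrow> nat \<Rightarrow> nat" where
  "third i j = (THE k. {k} = {1, 2, 3} - {i, j})"

text \<open>
  The identity is compared in the fraction field \<open>\<rat>(q)\<close> of \<open>\<int>[q]\<close>; no \<open>q\<close>-factorial occurring
  there is zero, so the convention \<open>x / 0 = 0\<close> plays no role.
\<close>

definition q_fract :: "int poly fract" where
  "q_fract = to_fract [:0, 1:]"

end

theory Submission
  imports Defs
begin

text \<open>
  The finite Jacobi triple product expands \<open>(z;q)\<^sub>n (q/z;q)\<^sub>n\<close> as
  \<open>\<Sum>\<^sub>k (-1)\<^sup>k q\<^bsup>k(k-1)/2\<^esup> [2n; n+k]\<^sub>q z\<^sup>k\<close>. Monomials from the three factors cancel exactly when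
  their exponents are \<open>k, -k, k\<close>, so the constant term is
  \<open>\<Sum>\<^sub>k (-1)\<^sup>k q\<^bsup>k(3k-1)/2\<^esup> \<Prod>\<^sub>i [2a\<^sub>i; a\<^sub>i+k]\<^sub>q\<close>. Up to \<open>q\<close>-factorials independent of \<open>k\<close>
  this is the sum in the \<open>q\<close>-Dixon identity, which is proved by induction on \<open>a\<^sub>1\<close> with a WZ
  certificate. The summand itself has no simple certificate, but its symmetrization under
  \<open>k \<mapsto> -k\<close>, which amounts to the factor \<open>1 + q\<^sup>k\<close>, does.
\<close>

section \<open>Reciprocal q-factorials and theta coefficients\<close>

text \<open>
  \<open>1 / (q;q)\<^sub>j\<close> with the value \<open>0\<close> for \<open>j < 0\<close>: then its recurrence holds for all integers and
  sums over \<open>k\<close> have natural boundaries.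
\<close>

definition qpoch_recip :: "'a::field \<Rightarrow> int \<Rightarrow> 'a" where
  "qpoch_recip q j = (if j < 0 then 0 else inverse (qpoch q q (nat j)))"

text \<open>The coefficient of z^k in the Jacobi theta series; \<open>div 2\<close> is exact because
  k(k-1) is even.\<close>

definition theta_coeff :: "'a::field \<Rightarrow> int \<Rightarrow> 'a" where
  "theta_coeff q k = (if even k then 1 else - 1) * q powi (k * (k - 1) div 2)"

lemma qpoch_Suc: "qpoch x q (Suc n) = qpoch x q n * (1 - x * q ^ n)"
  by (simp add: qpoch_def)

lemma theta_coeff_0 [simp]: "theta_coeff q 0 = 1"
  by (simp add: theta_coeff_def)

lemma theta_coeff_succ:
  assumes "q \<noteq> 0"
  shows "theta_coeff q (k + 1) = - (q powi k) * theta_coeff q k"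
proof -
  have "(k + 1) * k = k * (k - 1) + k * 2" by (simp add: algebra_simps)
  then have "(k + 1) * (k + 1 - 1) div 2 = k * (k - 1) div 2 + k" by simp
  then show ?thesis
    using assms unfolding theta_coeff_def by (simp add: power_int_add)
qed

lemma theta_coeff_uminus:
  assumes "q \<noteq> 0"
  shows "theta_coeff q (- k) = q powi k * theta_coeff q k"
proof -
  have "(- k) * (- k - 1) = k * (k - 1) + k * 2" by (simp add: algebra_simps)
  then have "(- k) * (- k - 1) div 2 = k * (k - 1) div 2 + k" by simp
  then show ?thesis
    using assms unfolding theta_coeff_def by (simp add: power_int_add power_int_minus)
qed

text \<open>Negative powers of q make sense, and every (q;q)_n is invertible.\<close>

locale non_root_of_unity =
  fixes q :: "'a::field"
  assumes q_nonzero: "q \<noteq> 0"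
    and q_power_neq_1: "n > 0 \<Longrightarrow> q ^ n \<noteq> 1"
begin

abbreviation "r \<equiv> qpoch_recip q"
abbreviation "t \<equiv> theta_coeff q"

lemma qpoch_nonzero: "qpoch q q n \<noteq> 0"
  using q_power_neq_1[of "Suc _"] by (auto simp: qpoch_def)

text \<open>At \<open>j = 0\<close> the factor 1 - q^0 vanishes, matching the value 0 at negative
  indices.\<close>

lemma qpoch_recip_pred: "r (j - 1) = (1 - q powi j) * r j"
proof (cases "j > 0")
  case True
  then obtain n where j: "j = int (Suc n)"
    by (metis gr0_implies_Suc zero_less_imp_eq_int)
  have "r (j - 1) = inverse (qpoch q q n)" by (simp add: j qpoch_recip_def)
  moreover have "r j = inverse (qpoch q q n * (1 - q powi j))"
    unfolding j qpoch_recip_def nat_int power_int_of_nat by (simp add: qpoch_Suc)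
  moreover have "1 - q powi j \<noteq> 0"
    unfolding j power_int_of_nat using q_power_neq_1[of "Suc n"] by auto
  ultimately show ?thesis
    by simp
qed (auto simp: qpoch_recip_def)

lemma qpoch_recip_succ: "r j = (1 - q * q powi j) * r (j + 1)"
  using qpoch_recip_pred[of "j + 1"] q_nonzero by (simp add: power_int_add mult.commute)

lemma qpoch_recip_neg [simp]: "j < 0 \<Longrightarrow> r j = 0"
  by (simp add: qpoch_recip_def)

lemma qpoch_recip_nat: "r (int n) = inverse (qpoch q q n)"
  by (simp add: qpoch_recip_def)

section \<open>The q-Dixon identity\<close>

text \<open>The prefactor is (-1)^k q^(k(3k-1)/2). It arises as
  \<open>t k * t (- k) * t k\<close>.\<close>

definition dixon_term :: "nat \<Rightarrow> nat \<Rightarrow> nat \<Rightarrow> int \<Rightarrow> 'a" where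
  "dixon_term a b c k = q powi k * t k ^ 3 *
     (r (a + k) * r (a - k)) * (r (b + k) * r (b - k)) * (r (c + k) * r (c - k))"

text \<open>The WZ companion of the symmetrized summand. The reciprocals containing \<open>a\<close>
  make it vanish for k < -a and for k > a+1.\<close>

definition dixon_cert :: "nat \<Rightarrow> nat \<Rightarrow> nat \<Rightarrow> int \<Rightarrow> 'a" where
  "dixon_cert a b c k = - (q ^ Suc a * t k ^ 3 *
     (r (a + k) * r (int a + 1 - k)) * (r (b + k - 1) * r (b - k)) * (r (c + k - 1) * r (c - k)))"

lemma dixon_term_uminus: "dixon_term a b c (- k) = q powi k * dixon_term a b c k"
proof -
  have "q powi (- k) * t (- k) ^ 3 = q powi k * (q powi k * t k ^ 3)"
    using q_nonzero
    by (simp add: theta_coeff_uminus power_int_minus field_simps power3_eq_cube)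
  then show ?thesis
    unfolding dixon_term_def by (simp add: mult_ac)
qed

lemma sum_dixon_term_symmetrized:
  "(\<Sum>k\<in>{- N..N}. (1 + q powi k) * dixon_term a b c k) = 2 * (\<Sum>k\<in>{- N..N}. dixon_term a b c k)"
proof -
  have "(\<Sum>k\<in>{- N..N}. dixon_term a b c k) = (\<Sum>k\<in>{- N..N}. dixon_term a b c (- k))"
    by (rule sum.reindex_bij_witness[of _ uminus uminus]) auto
  then show ?thesis
    by (simp add: dixon_term_uminus ring_distribs sum.distrib)
qed

text \<open>All terms are multiples of \<open>t k ^ 3 * R\<close>; the cofactors satisfy a Laurent
  polynomial identity in x = q^k and A, B, C, isolated as \<open>key\<close>.\<close>

lemma dixon_telescope:
  "(1 + q powi k) * ((1 - q ^ (a + 1)) * (1 - q ^ (a + b + 1)) * (1 - q ^ (a + c + 1)) * dixon_term (Suc a) b c k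
      - (1 - q ^ (a + b + c + 1)) * dixon_term a b c k)
   = dixon_cert a b c (k + 1) - dixon_cert a b c k"
proof -
  define A B C x where "A = q ^ a" and "B = q ^ b" and "C = q ^ c" and "x = q powi k"
  have x: "x \<noteq> 0" using q_nonzero by (simp add: x_def)
  \<comment> \<open>Each reciprocal is taken at its largest occurring index, so passing to a lower
    index only multiplies by a factor, without division.\<close>
  define R where "R = (r (a + k + 1) * r (int a + 1 - k)) * (r (b + k) * r (b - k)) * (r (c + k) * r (c - k))"
  have pd: "q powi (int n + k) = q ^ n * x" "q powi (int n - k) = q ^ n / x" for n
    using q_nonzero by (simp_all add: x_def power_int_add power_int_diff)
  have r1: "r (a + k) = (1 - q * A * x) * r (a + k + 1)"
    using qpoch_recip_succ[of "a + k"] by (simp add: pd A_def mult.assoc)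
  have r2: "r (a - k) = (1 - q * A / x) * r (int a + 1 - k)"
    using qpoch_recip_succ[of "a - k"] by (simp add: pd A_def mult.assoc algebra_simps)
  have r3: "r (n + k - 1) = (1 - q ^ n * x) * r (n + k)" for n :: nat
    using qpoch_recip_pred[of "n + k"] by (simp add: pd)
  have r4: "r (n - (k + 1)) = (1 - q ^ n / x) * r (n - k)" for n :: nat
    using qpoch_recip_pred[of "n - k"] by (simp add: pd algebra_simps)
  have d1: "dixon_term (Suc a) b c k = x * t k ^ 3 * R"
    by (simp add: dixon_term_def R_def x_def algebra_simps)
  have d0: "dixon_term a b c k = x * t k ^ 3 * ((1 - q * A * x) * (1 - q * A / x)) * R"
    unfolding dixon_term_def R_def x_def[symmetric] r1 r2 by (simp only: mult_ac)
  have g0: "dixon_cert a b c k = - (q * A * t k ^ 3 * ((1 - q * A * x) * (1 - B * x) * (1 - C * x)) * R)"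
    unfolding dixon_cert_def R_def r1 r3 A_def B_def C_def power_Suc by (simp only: mult_ac)
  have "dixon_cert a b c (k + 1) = - (q * A * t (k + 1) ^ 3 *
     (r (a + k + 1) * r (a - k)) * (r (b + k) * r (b - (k + 1))) * (r (c + k) * r (c - (k + 1))))"
    unfolding dixon_cert_def A_def by (simp add: algebra_simps)
  also have "t (k + 1) ^ 3 = - (x ^ 3 * t k ^ 3)"
    using q_nonzero by (simp add: theta_coeff_succ x_def power_mult_distrib power_minus_odd)
  finally have g1: "dixon_cert a b c (k + 1) =
      q * A * x ^ 3 * t k ^ 3 * ((1 - q * A / x) * (1 - B / x) * (1 - C / x)) * R"
    unfolding r2 r4 A_def B_def C_def R_def by (simp add: mult_ac)
  have key: "(1 + x) * ((1 - q * A) * (1 - q * A * B) * (1 - q * A * C) * x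
        - (1 - q * A * B * C) * (x * ((1 - q * A * x) * (1 - q * A / x))))
      = q * A * x ^ 3 * ((1 - q * A / x) * (1 - B / x) * (1 - C / x))
        + q * A * ((1 - q * A * x) * (1 - B * x) * (1 - C * x))" (is "?l = ?r")
  proof -
    \<comment> \<open>The powers of x absorb the denominators, leaving a polynomial identity for
      \<open>algebra\<close>.\<close>
    have 1: "x * ((1 - q * A * x) * (1 - q * A / x)) = (1 - q * A * x) * (x - q * A)"
      using x by (simp add: field_simps)
    have 2: "x ^ 3 * ((1 - q * A / x) * (1 - B / x) * (1 - C / x)) = (x - q * A) * (x - B) * (x - C)"
      using x by (simp add: field_simps power3_eq_cube)
    show ?thesis
      unfolding 1 mult.assoc[of "q * A" "x ^ 3"] 2 by algebra
  qed
  have "(1 + x) * ((1 - q * A) * (1 - q * A * B) * (1 - q * A * C) * dixon_term (Suc a) b c k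
      - (1 - q * A * B * C) * dixon_term a b c k) = t k ^ 3 * R * ?l"
    unfolding d0 d1 by (simp only: ring_distribs mult_ac)
  also have "\<dots> = dixon_cert a b c (k + 1) - dixon_cert a b c k"
    unfolding key g0 g1 by (simp add: algebra_simps)
  finally show ?thesis
    by (simp add: x_def A_def B_def C_def power_add mult_ac)
qed

lemma sum_telescope_int:
  fixes g :: "int \<Rightarrow> 'a"
  shows "(\<Sum>k\<in>{- int N..int N}. g (k + 1) - g k) = g (int N + 1) - g (- int N)"
proof -
  have "(\<Sum>k\<in>{- int N..int N}. g (k + 1) - g k) = (\<Sum>i<2 * N + 1. g (- int N + int (Suc i)) - g (- int N + int i))"
    by (rule sum.reindex_bij_witness[of _ "\<lambda>i. - int N + int i" "\<lambda>k. nat (k + int N)"]) (auto simp: algebra_simps)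
  also have "\<dots> = g (int N + 1) - g (- int N)"
    by (subst sum_lessThan_telescope) (simp add: algebra_simps)
  finally show ?thesis .
qed

text \<open>Telescoping gives a first-order recurrence in \<open>a\<close> that the product side
  also satisfies. Symmetrization doubles the sums, so 2 must be cancellable.\<close>

theorem q_dixon:
  assumes two: "(2::'a) \<noteq> 0" and N: "a \<le> N"
  shows "(\<Sum>k\<in>{- int N..int N}. dixon_term a b c k) * (qpoch q q a * qpoch q q b * qpoch q q c *
      (qpoch q q (a + b) * qpoch q q (a + c) * qpoch q q (b + c))) = qpoch q q (a + b + c)"
  using N
proof (induction a)
  case 0
  \<comment> \<open>For a = 0 the product \<open>r k * r (- k)\<close> leaves only k = 0.\<close>
  have "dixon_term 0 b c k = (if k = 0 then (r b * r c) ^ 2 else 0)" for k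
    by (auto simp: dixon_term_def qpoch_recip_def qpoch_def power2_eq_square)
  then show ?case
    using qpoch_nonzero by (simp add: qpoch_recip_nat power2_eq_square field_simps qpoch_def[of q q 0])
next
  case (Suc a)
  let ?S = "\<lambda>a. \<Sum>k\<in>{- int N..int N}. dixon_term a b c k"
  let ?u = "(1 - q ^ (a + 1)) * (1 - q ^ (a + b + 1)) * (1 - q ^ (a + c + 1))"
  let ?v = "1 - q ^ (a + b + c + 1)"
  have "2 * (?u * ?S (Suc a) - ?v * ?S a) =
     ?u * (\<Sum>k\<in>{- int N..int N}. (1 + q powi k) * dixon_term (Suc a) b c k)
     - ?v * (\<Sum>k\<in>{- int N..int N}. (1 + q powi k) * dixon_term a b c k)"
    unfolding sum_dixon_term_symmetrized by (simp only: ring_distribs mult_ac)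
  also have "\<dots> = (\<Sum>k\<in>{- int N..int N}. dixon_cert a b c (k + 1) - dixon_cert a b c k)"
    unfolding dixon_telescope[symmetric] sum_distrib_left sum_subtractf[symmetric]
    by (intro sum.cong refl) (simp only: right_diff_distrib mult_ac)
  also have "\<dots> = dixon_cert a b c (int N + 1) - dixon_cert a b c (- int N)"
    by (rule sum_telescope_int)
  \<comment> \<open>Since a+1 \<le> N, \<open>r (int a + 1 - k)\<close> vanishes at k = N+1 and
    \<open>r (a + k)\<close> at k = -N.\<close>
  also have "\<dots> = 0"
    using Suc.prems by (simp add: dixon_cert_def)
  finally have rec: "?u * ?S (Suc a) = ?v * ?S a"
    using two by simp
  let ?D = "qpoch q q a * qpoch q q b * qpoch q q c *
      (qpoch q q (a + b) * qpoch q q (a + c) * qpoch q q (b + c))"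
  have "?S (Suc a) * (qpoch q q (Suc a) * qpoch q q b * qpoch q q c *
      (qpoch q q (Suc a + b) * qpoch q q (Suc a + c) * qpoch q q (b + c)))
      = (?u * ?S (Suc a)) * ?D"
    by (simp add: qpoch_Suc mult_ac)
  also have "\<dots> = ?v * (?S a * ?D)"
    unfolding rec by (simp only: mult_ac)
  also have "?S a * ?D = qpoch q q (a + b + c)"
    using Suc by simp
  finally show ?case
    by (simp add: qpoch_Suc mult_ac)
qed

section \<open>Coefficients of the finite Jacobi triple product\<close>

text \<open>The coefficient of z^k in (z;q)_m (q/z;q)_n, a signed q-power times a q-binomial.
  Separate m and n allow adjoining one factor at a time.\<close>

definition triple_coeff :: "nat \<Rightarrow> nat \<Rightarrow> int \<Rightarrow> 'a" where
  "triple_coeff m n k = t k * qpoch q q (m + n) * (r (n + k) * r (m - k))"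

lemma triple_coeff_0_0: "triple_coeff 0 0 k = of_bool (k = 0)"
  by (auto simp: triple_coeff_def qpoch_recip_def qpoch_def)

lemma triple_coeff_outside: "k \<notin> {- int n..int m} \<Longrightarrow> triple_coeff m n k = 0"
  by (auto simp: triple_coeff_def)

text \<open>A q-Pascal rule, for adjoining the factor 1 - z q^m. With x = q^k it reduces to 1 -
  q^(m+n+1) = (1 - q^(m+1)/x) + (q^(m+1)/x)(1 - q^n x).\<close>

lemma triple_coeff_Suc_left:
  "triple_coeff (Suc m) n k = triple_coeff m n k - q ^ m * triple_coeff m n (k - 1)"
proof -
  define x where "x = q powi k"
  have x: "x \<noteq> 0" using q_nonzero by (simp add: x_def)
  have pd: "q powi (int n + k) = q ^ n * x" "q powi (int n - k) = q ^ n / x" for n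
    using q_nonzero by (simp_all add: x_def power_int_add power_int_diff)
  have "t k = - (x / q) * t (k - 1)"
    using theta_coeff_succ[OF q_nonzero, of "k - 1"] q_nonzero by (simp add: x_def power_int_diff)
  then have 1: "t (k - 1) = - (q / x) * t k" using x q_nonzero by simp
  have 2: "r (n + (k - 1)) = (1 - q ^ n * x) * r (n + k)"
    using qpoch_recip_pred[of "n + k"] unfolding pd by (simp add: algebra_simps)
  have 3: "r (m - k) = (1 - q * q ^ m / x) * r (int m + 1 - k)"
    using qpoch_recip_succ[of "m - k"] by (simp add: pd algebra_simps)
  have 4: "r (m - (k - 1)) = r (int m + 1 - k)" "r (int (Suc m) - k) = r (int m + 1 - k)"
    by (simp_all add: algebra_simps)
  show ?thesis
    unfolding triple_coeff_def 1 2 3 4 using x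
    by (simp add: qpoch_Suc power_add field_simps)
qed

text \<open>The companion rule, for adjoining 1 - q^(n+1)/z.\<close>

lemma triple_coeff_Suc_right:
  "triple_coeff m (Suc n) k = triple_coeff m n k - q ^ Suc n * triple_coeff m n (k + 1)"
proof -
  define x where "x = q powi k"
  have x: "x \<noteq> 0" using q_nonzero by (simp add: x_def)
  have pd: "q powi (int n + k) = q ^ n * x" "q powi (int n - k) = q ^ n / x" for n
    using q_nonzero by (simp_all add: x_def power_int_add power_int_diff)
  have 1: "t (k + 1) = - x * t k"
    by (simp add: theta_coeff_succ[OF q_nonzero] x_def)
  have 2: "r (n + k) = (1 - q * q ^ n * x) * r (n + (k + 1))"
    using qpoch_recip_succ[of "n + k"] unfolding pd by (simp add: algebra_simps)
  have 3: "r (m - (k + 1)) = (1 - q ^ m / x) * r (m - k)"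
    using qpoch_recip_pred[of "m - k"] by (simp add: pd algebra_simps)
  have 4: "r (int (Suc n) + k) = r (n + (k + 1))"
    by (simp add: algebra_simps)
  show ?thesis
    unfolding triple_coeff_def 1 2 3 4 using x
    by (simp add: qpoch_Suc power_add field_simps)
qed

end

section \<open>The finite triple product in a group algebra over Z[q]\<close>

lemma q_fract_power: "q_fract ^ n = to_fract (monom 1 n)"
  by (induction n) (simp_all add: q_fract_def monom_Suc flip: to_fract_mult)

interpretation q_fract: non_root_of_unity q_fract
proof
  show "q_fract \<noteq> 0" by (simp add: q_fract_def)
  show "q_fract ^ n \<noteq> 1" if "n > 0" for n
  proof
    assume "q_fract ^ n = 1"
    then have "monom 1 n = (1 :: int poly)"
      by (simp add: q_fract_power flip: to_fract_1)
    then have "degree (monom (1::int) n) = 0" by simp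
    with that show False by (simp add: degree_monom_eq)
  qed
qed

text \<open>The additive map \<open>e\<close> embeds the powers of one variable z as z^k =
  \<open>e k\<close>, so the same computation serves every ratio y_i/y_j. The set \<open>A\<close>
  has room for both the old and the shifted support.\<close>

lemma sum_single_mult_binomial:
  fixes e :: "int \<Rightarrow> 'k::ab_group_add" and c :: "int \<Rightarrow> 'b::comm_ring_1"
  assumes add: "\<And>i j. e (i + j) = e i + e j"
    and supp: "\<And>k. k \<notin> I \<Longrightarrow> c k = 0"
    and A: "finite A" "I \<subseteq> A" "(\<lambda>k. k + s) ` I \<subseteq> A"
  shows "(\<Sum>k\<in>I. Poly_Mapping.single (e k) (c k)) * (1 - Poly_Mapping.single (e s) p)
    = (\<Sum>k\<in>A. Poly_Mapping.single (e k) (c k - p * c (k - s)))"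
proof -
  have "(\<Sum>k\<in>I. Poly_Mapping.single (e k) (c k)) * (1 - Poly_Mapping.single (e s) p)
    = (\<Sum>k\<in>I. Poly_Mapping.single (e k) (c k)) - (\<Sum>k\<in>I. Poly_Mapping.single (e (k + s)) (p * c k))"
    by (simp add: right_diff_distrib sum_distrib_right mult_single add mult.commute[of p])
  moreover have "(\<Sum>k\<in>I. Poly_Mapping.single (e k) (c k)) = (\<Sum>k\<in>A. Poly_Mapping.single (e k) (c k))"
    using A by (intro sum.mono_neutral_left) (auto simp: supp)
  moreover have "(\<Sum>k\<in>I. Poly_Mapping.single (e (k + s)) (p * c k))
    = (\<Sum>k\<in>(\<lambda>k. k + s) ` I. Poly_Mapping.single (e k) (p * c (k - s)))"
    by (subst sum.reindex) (auto simp: inj_on_def)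
  moreover have "(\<Sum>k\<in>(\<lambda>k. k + s) ` I. Poly_Mapping.single (e k) (p * c (k - s)))
    = (\<Sum>k\<in>A. Poly_Mapping.single (e k) (p * c (k - s)))"
  proof (rule sum.mono_neutral_left[OF A(1,3)], rule ballI)
    fix k assume "k \<in> A - (\<lambda>k. k + s) ` I"
    then have "k - s \<notin> I" by force
    then show "Poly_Mapping.single (e k) (p * c (k - s)) = 0" by (simp add: supp)
  qed
  ultimately show ?thesis
    by (simp add: single_diff sum_subtractf)
qed

text \<open>
  A finite form of the Jacobi triple product. The coefficients are polynomials in \<open>q\<close> (signed
  \<open>q\<close>-binomial coefficients up to a power of \<open>q\<close>), determined by their images in \<open>\<rat>(q)\<close>.
\<close>

lemma finite_triple_product:
  fixes e :: "int \<Rightarrow> 'k::ab_group_add"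
  assumes add: "\<And>i j. e (i + j) = e i + e j"
  defines "Q \<equiv> Poly_Mapping.single 0 [:0, 1:]"
  shows "\<exists>c :: int \<Rightarrow> int poly.
    qpoch (Poly_Mapping.single (e 1) 1) Q m * qpoch (Q * Poly_Mapping.single (e (-1)) 1) Q n
      = (\<Sum>k\<in>{- int n..int m}. Poly_Mapping.single (e k) (c k)) \<and>
    (\<forall>k. to_fract (c k) = q_fract.triple_coeff m n k)"
proof -
  let ?z = "Poly_Mapping.single (e 1) (1 :: int poly)"
  let ?z' = "Poly_Mapping.single (e (-1)) (1 :: int poly)"
  let ?P = "\<lambda>m n (c :: int \<Rightarrow> int poly). qpoch ?z Q m * qpoch (Q * ?z') Q n
      = (\<Sum>k\<in>{- int n..int m}. Poly_Mapping.single (e k) (c k)) \<and>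
      (\<forall>k. to_fract (c k) = q_fract.triple_coeff m n k)"
  have e0: "e 0 = 0" using add[of 0 0] by simp
  have Qpow: "Q ^ i = Poly_Mapping.single 0 (monom 1 i)" for i
    by (induction i) (simp_all add: Q_def mult_single monom_Suc)
  \<comment> \<open>Vanishing is inherited from Q(q) because \<open>to_fract\<close> is
    injective.\<close>
  have supp: "c k = 0" if "?P m n c" "k \<notin> {- int n..int m}" for m n c k
    using that q_fract.triple_coeff_outside[of k n m] by (metis to_fract_eq_0_iff)
  \<comment> \<open>First m grows with n = 0; afterwards n grows with m fixed.\<close>
  have row: "\<exists>c. ?P m 0 c" for m
  proof (induction m)
    case 0
    have "to_fract (of_bool (k = 0)) = q_fract.triple_coeff 0 0 k" for k
      by (simp add: q_fract.triple_coeff_0_0)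
    then show ?case
      by (intro exI[of _ "\<lambda>k. of_bool (k = 0)"]) (simp add: qpoch_def e0)
  next
    case (Suc m)
    then obtain c where c: "?P m 0 c" by blast
    have "qpoch ?z Q (Suc m) * qpoch (Q * ?z') Q 0 =
        (qpoch ?z Q m * qpoch (Q * ?z') Q 0) * (1 - Poly_Mapping.single (e 1) (monom 1 m))"
      by (simp add: qpoch_Suc Qpow mult_single mult_ac)
    also have "\<dots> = (\<Sum>k\<in>{- int 0..int m}. Poly_Mapping.single (e k) (c k)) * (1 - Poly_Mapping.single (e 1) (monom 1 m))"
      using c by simp
    also have "\<dots> = (\<Sum>k\<in>{- int 0..int (Suc m)}. Poly_Mapping.single (e k) (c k - monom 1 m * c (k - 1)))"
      by (rule sum_single_mult_binomial[OF add supp[OF c]]) auto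
    finally show ?case
      using c by (intro exI[of _ "\<lambda>k. c k - monom 1 m * c (k - 1)"])
        (simp add: to_fract_diff to_fract_mult q_fract.triple_coeff_Suc_left flip: q_fract_power)
  qed
  show ?thesis
  proof (induction n)
    case 0
    show ?case by (rule row)
  next
    case (Suc n)
    then obtain c where c: "?P m n c" by blast
    have Qz': "Q * ?z' * Q ^ n = Poly_Mapping.single (e (-1)) (monom 1 (Suc n))"
      unfolding Qpow unfolding Q_def by (simp add: mult_single monom_Suc)
    have "qpoch ?z Q m * qpoch (Q * ?z') Q (Suc n) =
        (\<Sum>k\<in>{- int n..int m}. Poly_Mapping.single (e k) (c k)) * (1 - Poly_Mapping.single (e (-1)) (monom 1 (Suc n)))"
      using c Qz' by (simp add: qpoch_Suc flip: mult.assoc)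
    \<comment> \<open>The new factor shifts by s = -1, whence the index \<open>k - - 1\<close>, that
      is, k+1.\<close>
    also have "\<dots> = (\<Sum>k\<in>{- int (Suc n)..int m}. Poly_Mapping.single (e k) (c k - monom 1 (Suc n) * c (k - - 1)))"
      by (rule sum_single_mult_binomial[OF add supp[OF c]]) auto
    finally show ?case
      using c by (intro exI[of _ "\<lambda>k. c k - monom 1 (Suc n) * c (k - - 1)"])
        (simp add: to_fract_diff to_fract_mult q_fract.triple_coeff_Suc_right flip: q_fract_power)
  qed
qed

text \<open>Zero padding to any N \<ge> n, with the same \<open>c\<close> for all N, lets factors of
  different lengths share one range.\<close>

lemma triple_product_expansion:
  fixes e :: "int \<Rightarrow> int \<times> int \<times> int"
  assumes add: "\<And>i j. e (i + j) = e i + e j"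
  obtains c where
    "\<And>N. n \<le> N \<Longrightarrow> qpoch (Poly_Mapping.single (e 1) 1) q_laurent n *
        qpoch (q_laurent * Poly_Mapping.single (e (-1)) 1) q_laurent n
      = (\<Sum>k\<in>{- int N..int N}. Poly_Mapping.single (e k) (c k))"
    "\<And>k. to_fract (c k) = q_fract.triple_coeff n n k"
proof -
  obtain c where c: "qpoch (Poly_Mapping.single (e 1) 1) q_laurent n *
        qpoch (q_laurent * Poly_Mapping.single (e (-1)) 1) q_laurent n
      = (\<Sum>k\<in>{- int n..int n}. Poly_Mapping.single (e k) (c k))"
    and tc: "\<And>k. to_fract (c k) = q_fract.triple_coeff n n k"
    using finite_triple_product[OF add, where m = n and n = n] unfolding q_laurent_def by blast
  have "c k = 0" if "k \<notin> {- int n..int n}" for k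
    using q_fract.triple_coeff_outside[OF that] tc[of k] by simp
  then have "(\<Sum>k\<in>{- int n..int n}. Poly_Mapping.single (e k) (c k))
      = (\<Sum>k\<in>{- int N..int N}. Poly_Mapping.single (e k) (c k))" if "n \<le> N" for N
    using that by (intro sum.mono_neutral_left) auto
  with c tc show thesis by (intro that) auto
qed

section \<open>Constant term extraction and final evaluation\<close>

text \<open>The exponents (k,-k,0), (l,0,-l), (0,m,-m) sum to zero only if l = -k and m = k; closure
  under negation keeps l in \<open>I\<close>.\<close>

lemma CT_theta_product:
  fixes c d f :: "int \<Rightarrow> int poly"
  assumes "finite I" and "\<And>k. k \<in> I \<Longrightarrow> - k \<in> I"
  shows "CT ((\<Sum>k\<in>I. Poly_Mapping.single (k, - k, 0) (c k)) *
             (\<Sum>k\<in>I. Poly_Mapping.single (k, 0, - k) (d k)) *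
             (\<Sum>k\<in>I. Poly_Mapping.single (0, k, - k) (f k)))
         = (\<Sum>k\<in>I. c k * d (- k) * f k)"
proof -
  have "CT ((\<Sum>k\<in>I. Poly_Mapping.single (k, - k, 0) (c k)) *
             (\<Sum>k\<in>I. Poly_Mapping.single (k, 0, - k) (d k)) *
             (\<Sum>k\<in>I. Poly_Mapping.single (0, k, - k) (f k)))
     = (\<Sum>k\<in>I. \<Sum>l\<in>I. \<Sum>m\<in>I. if l = - k \<and> m = k then c k * d l * f m else 0)"
    unfolding CT_def sum_product sum_distrib_right sum_distrib_left
    by (simp add: mult_single lookup_sum lookup_single when_def plus_prod_def)
       (intro sum.cong refl, auto)
  also have "\<dots> = (\<Sum>k\<in>I. \<Sum>l\<in>I. if l = - k then c k * d l * f k else 0)"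
    using assms(1) by (intro sum.cong refl) (auto simp: sum.delta')
  also have "\<dots> = (\<Sum>k\<in>I. c k * d (- k) * f k)"
    using assms by (intro sum.cong refl) (auto simp: sum.delta')
  finally show ?thesis .
qed

lemma third_values: "third 1 2 = 3" "third 1 3 = 2" "third 2 3 = 1"
  unfolding third_def by (rule the_equality; auto)+

theorem theorem1p4:
  fixes a :: "nat \<Rightarrow> nat"
  shows
    "to_fract (CT (\<Prod>(i, j) \<in> {(i, j). 1 \<le> i \<and> i < j \<and> j \<le> (3::nat)}.
        qpoch (y_ratio i j) q_laurent (a (third i j)) *
        qpoch (q_laurent * y_ratio j i) q_laurent (a (third i j))))
     = (qfact q_fract (a 1 + a 2 + a 3) * (\<Prod>i=1..3. qfact q_fract (2 * a i)))
       / ((\<Prod>i=1..3. qfact q_fract (a i)) *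
          (\<Prod>(i, j) \<in> {(i, j). 1 \<le> i \<and> i < j \<and> j \<le> (3::nat)}. qfact q_fract (a i + a j)))"
proof -
  \<comment> \<open>A common bound for all three lengths.\<close>
  define N where "N = a 1 + a 2 + a 3"
  have pairs: "{(i, j). 1 \<le> i \<and> i < j \<and> j \<le> (3::nat)} = {(1, 2), (1, 3), (2, 3)}"
    by auto
  \<comment> \<open>The unsimplified \<open>- (- 1)\<close> matches \<open>e (-1)\<close> for the
    maps \<open>e\<close> used below.\<close>
  have ratios:
    "y_ratio 1 2 = Poly_Mapping.single (1, - 1, 0) 1" "y_ratio 2 1 = Poly_Mapping.single (- 1, - (- 1), 0) 1"
    "y_ratio 1 3 = Poly_Mapping.single (1, 0, - 1) 1" "y_ratio 3 1 = Poly_Mapping.single (- 1, 0, - (- 1)) 1"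
    "y_ratio 2 3 = Poly_Mapping.single (0, 1, - 1) 1" "y_ratio 3 2 = Poly_Mapping.single (0, - 1, - (- 1)) 1"
    by (simp_all add: y_ratio_def y_pow_def mult_single)
  obtain c where c:
    "\<And>N. a 3 \<le> N \<Longrightarrow> qpoch (y_ratio 1 2) q_laurent (a 3) * qpoch (q_laurent * y_ratio 2 1) q_laurent (a 3)
      = (\<Sum>k\<in>{- int N..int N}. Poly_Mapping.single (k, - k, 0) (c k))"
    "\<And>k. to_fract (c k) = q_fract.triple_coeff (a 3) (a 3) k"
    unfolding ratios by (rule triple_product_expansion[of "\<lambda>k. (k, - k, 0)" "a 3"]) (simp, blast)
  obtain d where d:
    "\<And>N. a 2 \<le> N \<Longrightarrow> qpoch (y_ratio 1 3) q_laurent (a 2) * qpoch (q_laurent * y_ratio 3 1) q_laurent (a 2)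
      = (\<Sum>k\<in>{- int N..int N}. Poly_Mapping.single (k, 0, - k) (d k))"
    "\<And>k. to_fract (d k) = q_fract.triple_coeff (a 2) (a 2) k"
    unfolding ratios by (rule triple_product_expansion[of "\<lambda>k. (k, 0, - k)" "a 2"]) (simp, blast)
  obtain f where f:
    "\<And>N. a 1 \<le> N \<Longrightarrow> qpoch (y_ratio 2 3) q_laurent (a 1) * qpoch (q_laurent * y_ratio 3 2) q_laurent (a 1)
      = (\<Sum>k\<in>{- int N..int N}. Poly_Mapping.single (0, k, - k) (f k))"
    "\<And>k. to_fract (f k) = q_fract.triple_coeff (a 1) (a 1) k"
    unfolding ratios by (rule triple_product_expansion[of "\<lambda>k. (0, k, - k)" "a 1"]) (simp, blast)
  let ?p = "qpoch q_fract q_fract"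
  let ?S = "\<Sum>k\<in>{- int N..int N}. q_fract.dixon_term (a 1) (a 2) (a 3) k"
  let ?L = "\<Prod>(i, j) \<in> {(i, j). 1 \<le> i \<and> i < j \<and> j \<le> (3::nat)}.
        qpoch (y_ratio i j) q_laurent (a (third i j)) *
        qpoch (q_laurent * y_ratio j i) q_laurent (a (third i j))"
  have "?L = (\<Sum>k\<in>{- int N..int N}. Poly_Mapping.single (k, - k, 0) (c k)) *
             (\<Sum>k\<in>{- int N..int N}. Poly_Mapping.single (k, 0, - k) (d k)) *
             (\<Sum>k\<in>{- int N..int N}. Poly_Mapping.single (0, k, - k) (f k))"
    unfolding pairs using c(1)[of N] d(1)[of N] f(1)[of N]
    by (simp add: third_values[simplified] N_def mult.assoc)
  then have "CT ?L = (\<Sum>k\<in>{- int N..int N}. c k * d (- k) * f k)"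
    by (simp only:) (rule CT_theta_product; auto)
  also have "to_fract \<dots> = (\<Sum>k\<in>{- int N..int N}. to_fract (c k) * to_fract (d (- k)) * to_fract (f k))"
    by (simp add: to_fract_sum to_fract_mult)
  \<comment> \<open>The middle coefficient is taken at -k, and t(-k) = q^k t(k) supplies the power
    of q in \<open>dixon_term\<close>.\<close>
  also have "\<dots> = ?p (2 * a 1) * ?p (2 * a 2) * ?p (2 * a 3) * ?S"
    unfolding sum_distrib_left c(2) d(2) f(2)
    by (intro sum.cong refl)
      (simp add: q_fract.triple_coeff_def q_fract.dixon_term_def
        theta_coeff_uminus[OF q_fract.q_nonzero] power3_eq_cube mult_2 mult_ac)
  finally have CT: "to_fract (CT ?L) = ?p (2 * a 1) * ?p (2 * a 2) * ?p (2 * a 3) * ?S" .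
  have two: "(2 :: int poly fract) \<noteq> 0"
    by (metis to_fract_1 to_fract_add one_add_one to_fract_eq_0_iff zero_neq_numeral)
  have dixon: "?S = ?p (a 1 + a 2 + a 3) / (?p (a 1) * ?p (a 2) * ?p (a 3) *
      (?p (a 1 + a 2) * ?p (a 1 + a 3) * ?p (a 2 + a 3)))"
    using q_fract.q_dixon[OF two, of "a 1" N "a 2" "a 3"] q_fract.qpoch_nonzero
    by (simp add: N_def eq_divide_eq)
  have prod3: "(\<Prod>i=1..3. g i) = g 1 * g 2 * g 3" for g :: "nat \<Rightarrow> int poly fract"
    by (simp add: eval_nat_numeral)
  \<comment> \<open>The powers of 1 - q cancel: numerator and denominator both carry the exponent
    3(a_1+a_2+a_3).\<close>
  have "1 - q_fract \<noteq> 0"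
    using q_fract.q_power_neq_1[of 1] by auto
  then show ?thesis
    unfolding CT unfolding dixon pairs prod3 using q_fract.qpoch_nonzero
    by (simp add: qfact_def power_add mult_2 field_simps)
qed

end
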